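(* Let $(f_n)_{n\ge1}$ be a sequence of functions in $\mathcal{O}_+(D(0,1))$ such that the infinite product $\prod_{k\ge 1} f_k$ converges uniformly on every compact subset of $D(0,1)$. Then the function $f = \prod_{k \ge 1} f_k$ belongs to $\mathcal{O}_+(D(0,1))$, and for every $t\in\,]0,1[$ the sequence of probability measures $\mu_t(f_1\cdots f_n) = \mu_t(f_1)\ast\cdots\ast\mu_t(f_n)$ converges in law to $\mu_t(f)$ as $n \to +\infty$.
   Context: $D(0,1)$ is the open unit disk in $\mathbb{C}$. $\mathcal{O}_+(D(0,1))$ denotes the set of functions $f$ analytic with radius of convergence $1$ such that $f(z) = \sum_{n\ge 0} a_n z^n$ with all $a_n$ real and nonnegative and not all zero; in particular $f(t)>0$ for $t\in\,]0,1[$. For such $f$ and $t \in\, ]0,1[$, $\mu_t(f)$ is the discrete probability measure on $\mathbb{R}$ given by $\mu_t(f) = \sum_{n \ge 0} \frac{a_n t^n}{f(t)} \delta_n$, where $\delta_n$ is the Dirac mass at $n$. The symbol $\ast$ denotes convolution of measures. *)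

theory Defs
  imports "HOL-Probability.Probability" "HOL-Complex_Analysis.Complex_Analysis"
begin

(* Elements of O_plus are total functions on the complex plane of which only the restriction
   to the open unit disk is relevant; all notions below depend on that restriction only. *)
definition O_plus :: "(complex \<Rightarrow> complex) set" where
  "O_plus = {f. \<exists>a :: nat \<Rightarrow> real.
      (\<forall>n. 0 \<le> a n) \<and> (\<exists>n. a n \<noteq> 0) \<and> conv_radius a = 1 \<and>
      (\<forall>z \<in> ball 0 1. (\<lambda>n. complex_of_real (a n) * z ^ n) sums f z)}"

(* The coefficients a n in O_plus are unique, see taylor_coeff_O_plus. *)
definition taylor_coeff :: "(complex \<Rightarrow> complex) \<Rightarrow> nat \<Rightarrow> real" where
  "taylor_coeff f n = Re (fps_nth (fps_expansion f 0) n)"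

(* The sum of the Dirac masses at n weighted by a n * t ^ n / f t, as a Borel measure on the
   reals: the image of a weighted counting measure on the naturals, see emeasure_mu. *)
definition mu :: "real \<Rightarrow> (complex \<Rightarrow> complex) \<Rightarrow> real measure" where
  "mu t f = distr
     (density (count_space UNIV)
        (\<lambda>n. ennreal (taylor_coeff f n * t ^ n / Re (f (complex_of_real t)))))
     borel real"

(* M 1 \<star> ... \<star> M n; the empty convolution is the neutral element, the Dirac mass at 0,
   see return_0_convolution. *)
primrec iter_conv :: "(nat \<Rightarrow> real measure) \<Rightarrow> nat \<Rightarrow> real measure" where
  "iter_conv M 0 = return borel 0"
| "iter_conv M (Suc n) = (iter_conv M n \<star> M (Suc n))"

(* The product over k \<ge> 1 of f k converges at each point of S in the classical sense (at most
   finitely many zero factors, the product of the other ones having a nonzero limit), and the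
   partial products converge to it uniformly on the compact subsets of S. *)
definition prod_converges_compactly_on ::
    "(nat \<Rightarrow> complex \<Rightarrow> complex) \<Rightarrow> complex set \<Rightarrow> bool" where
  "prod_converges_compactly_on f S \<longleftrightarrow>
     (\<forall>z \<in> S. convergent_prod (\<lambda>k. f (Suc k) z)) \<and>
     (\<forall>K. compact K \<and> K \<subseteq> S \<longrightarrow>
        uniform_limit K (\<lambda>n z. \<Prod>k = 1..n. f k z) (\<lambda>z. \<Prod>k. f (Suc k) z) sequentially)"

lemma taylor_coeff_O_plus:
  assumes "\<And>z. z \<in> ball 0 1 \<Longrightarrow> (\<lambda>n. complex_of_real (a n) * z ^ n) sums f z"
  shows "taylor_coeff f = a"
proof -
  define F where "F = Abs_fps (\<lambda>n. complex_of_real (a n))"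
  have ev: "eval_fps F z = f z" if "z \<in> ball 0 1" for z
    using assms[OF that] by (simp add: eval_fps_def F_def sums_iff)
  have "fps_conv_radius F \<ge> 1"
    unfolding fps_conv_radius_def
  proof (rule conv_radius_geI_ex')
    fix r :: real assume "0 < r" "ereal r < 1"
    then have "complex_of_real r \<in> ball 0 1"
      by simp
    from sums_summable[OF assms[OF this]]
    show "summable (\<lambda>n. fps_nth F n * of_real r ^ n)"
      by (simp add: F_def)
  qed
  then have pos: "fps_conv_radius F > 0"
    by (rule less_le_trans[rotated]) simp
  have "eventually (\<lambda>z::complex. z \<in> ball 0 1) (nhds 0)"
    by (intro eventually_nhds_in_open) auto
  then have "f has_fps_expansion F"
    unfolding has_fps_expansion_def using pos ev by (auto elim: eventually_mono)
  then have "fps_expansion f 0 = F"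
    by (rule fps_expansion_eqI)
  then show ?thesis
    by (simp add: taylor_coeff_def F_def fun_eq_iff)
qed

lemma emeasure_mu:
  assumes "A \<in> sets borel"
  shows "emeasure (mu t f) A =
    (\<Sum>n. ennreal (taylor_coeff f n * t ^ n / Re (f (complex_of_real t))) *
         emeasure (return borel (real n)) A)"
proof -
  have "emeasure (mu t f) A =
      emeasure (density (count_space UNIV)
        (\<lambda>n. ennreal (taylor_coeff f n * t ^ n / Re (f (complex_of_real t))))) (real -` A)"
    using assms by (simp add: mu_def emeasure_distr)
  also have "\<dots> = (\<Sum>n. ennreal (taylor_coeff f n * t ^ n / Re (f (complex_of_real t))) *
      indicator (real -` A) n)"
    by (simp add: emeasure_density nn_integral_count_space_nat)
  also have "\<dots> = (\<Sum>n. ennreal (taylor_coeff f n * t ^ n / Re (f (complex_of_real t))) *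
      emeasure (return borel (real n)) A)"
    using assms by (intro suminf_cong) (simp split: split_indicator)
  finally show ?thesis .
qed

lemma real_distribution_mu:
  assumes f: "f \<in> O_plus" and t: "t \<in> {0<..<1}"
  shows "0 < Re (f (complex_of_real t))" and "real_distribution (mu t f)"
proof -
  obtain a :: "nat \<Rightarrow> real" where a: "\<And>n. 0 \<le> a n" "\<exists>n. a n \<noteq> 0"
    and s: "\<And>z. z \<in> ball 0 1 \<Longrightarrow> (\<lambda>n. complex_of_real (a n) * z ^ n) sums f z"
    using f unfolding O_plus_def by blast
  have coeff: "taylor_coeff f = a"
    using s by (rule taylor_coeff_O_plus)
  have "(\<lambda>n. complex_of_real (a n) * complex_of_real t ^ n) sums f (complex_of_real t)"
    using t by (intro s) auto
  from sums_Re[OF this]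
  have sm: "(\<lambda>n. a n * t ^ n) sums Re (f (complex_of_real t))"
    by (simp flip: of_real_power of_real_mult)
  obtain m where "0 < a m"
    using a by (metis order_le_imp_less_or_eq)
  then have "0 < (\<Sum>n. a n * t ^ n)"
    using a(1) t sums_summable[OF sm]
    by (intro suminf_pos2[where i = m] mult_nonneg_nonneg mult_pos_pos) auto
  then show pos: "0 < Re (f (complex_of_real t))"
    using sm by (simp add: sums_iff)
  have one: "(\<lambda>n. a n * t ^ n / Re (f (complex_of_real t))) sums 1"
    using sums_divide[OF sm, of "Re (f (complex_of_real t))"] pos by simp
  have "emeasure (mu t f) UNIV = (\<Sum>n. ennreal (a n * t ^ n / Re (f (complex_of_real t))))"
    by (simp add: emeasure_mu coeff)
  also have "\<dots> = ennreal 1"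
  proof (rule suminf_ennreal_eq[OF _ one])
    show "0 \<le> a n * t ^ n / Re (f (complex_of_real t))" for n
      using a(1)[of n] t pos by simp
  qed
  finally have "prob_space (mu t f)"
    by (intro prob_spaceI) (simp add: mu_def)
  then show "real_distribution (mu t f)"
    by (auto simp: real_distribution_def real_distribution_axioms_def mu_def)
qed

lemma return_0_convolution:
  fixes N :: "real measure"
  assumes "prob_space N" and N [measurable_cong]: "sets N = sets borel"
  shows "(return borel 0 \<star> N) = N"
proof (rule measure_eqI)
  interpret prob_space N by fact
  have r: "prob_space (return borel (0::real))"
    by (rule prob_space_return) simp
  fix A assume "A \<in> sets (return borel 0 \<star> N)"
  then have A [measurable]: "A \<in> sets borel" by simp
  have "emeasure (return borel 0 \<star> N) A =
      (\<integral>\<^sup>+x. \<integral>\<^sup>+y. indicator A (x + y) \<partial>N \<partial>return borel 0)"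
    using A N r finite_measure_axioms
    by (intro convolution_emeasure') (auto simp: prob_space_def)
  also have "\<dots> = (\<integral>\<^sup>+y. indicator A (0 + y) \<partial>N)"
    by (rule nn_integral_return) (simp, measurable)
  also have "\<dots> = emeasure N A"
    using A N by simp
  finally show "emeasure (return borel 0 \<star> N) A = emeasure N A" .
qed (use assms in simp)

end

theory Submission
  imports Defs
begin

text \<open>The characteristic function of \<^term>\<open>mu t f\<close> at \<open>x\<close> is \<open>f (t e\<^sup>i\<^sup>x) / f t\<close>. It is
  multiplicative in \<open>f\<close>, which gives the convolution formula, and it converges pointwise along
  the partial products, which gives convergence in law by Levy's continuity theorem. The
  coefficients of the infinite product are limits of those of the partial products by Cauchy's
  formula, hence nonnegative. To see that its radius of convergence is not larger than 1, split
  off a finite partial product containing all factors that vanish at 0: the constant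
  coefficients of the remaining partial products tend to a positive number, so the coefficients
  of the infinite product dominate a multiple of those of the finite one.\<close>

section \<open>Taylor coefficients of members of \<open>O_plus\<close>\<close>

lemma O_plus_sums:
  assumes "f \<in> O_plus" "norm z < 1"
  shows "(\<lambda>n. complex_of_real (taylor_coeff f n) * z ^ n) sums f z"
  using assms taylor_coeff_O_plus[of _ f] unfolding O_plus_def by fastforce

lemma
  assumes "f \<in> O_plus"
  shows taylor_coeff_nonneg: "0 \<le> taylor_coeff f n"
    and taylor_coeff_neq_0: "\<exists>n. taylor_coeff f n \<noteq> 0"
    and conv_radius_taylor_coeff: "conv_radius (taylor_coeff f) = 1"
  using assms taylor_coeff_O_plus[of _ f] unfolding O_plus_def by fastforce+

text \<open>\<open>taylor_coeff\<close> keeps only real parts. On \<open>O_plus\<close> nothing is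
  lost, since the real power series is already the full expansion.\<close>

lemma fps_expansion_O_plus:
  assumes "f \<in> O_plus"
  shows "fps_nth (fps_expansion f 0) n = complex_of_real (taylor_coeff f n)"
proof -
  have "eventually (\<lambda>z::complex. z \<in> ball 0 1) (nhds 0)"
    by (intro eventually_nhds_in_open) auto
  then have "f has_fps_expansion Abs_fps (\<lambda>n. complex_of_real (taylor_coeff f n))"
    by (intro has_fps_expansionI) (auto elim!: eventually_mono intro: O_plus_sums[OF assms])
  from fps_expansion_eqI[OF this] show ?thesis
    by simp
qed

lemma O_plus_holomorphic:
  assumes "f \<in> O_plus"
  shows "f holomorphic_on ball 0 1"
  by (rule power_series_holomorphic) (use O_plus_sums[OF assms] in simp)

lemma O_plus_of_real:
  assumes "f \<in> O_plus" "\<bar>t\<bar> < 1"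
  shows "f (complex_of_real t) = complex_of_real (Re (f (complex_of_real t)))"
proof -
  have "(\<lambda>n. complex_of_real (taylor_coeff f n * t ^ n)) sums f (complex_of_real t)"
    using O_plus_sums[OF assms(1), of "complex_of_real t"] assms(2) by simp
  from sums_Im[OF this] have "Im (f (complex_of_real t)) = 0"
    by (simp add: sums_iff)
  then show ?thesis
    by (simp add: complex_eq_iff)
qed

lemma taylor_coeff_0:
  assumes "f \<in> O_plus"
  shows "taylor_coeff f 0 = Re (f 0)"
  using O_plus_sums[OF assms, of 0] powser_sums_zero_iff[of "\<lambda>n. complex_of_real (taylor_coeff f n)" "f 0"]
  by (auto simp: complex_eq_iff)

section \<open>Membership criterion and closure under products\<close>

text \<open>Convergence of the series on the disk makes the radius at least 1. Domination of a
  multiple of the coefficients of \<open>g\<close> makes it at most 1 and rules out the zero series.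
  A shift by \<open>m\<close> does not change the radius.\<close>

lemma O_plusI:
  assumes g: "g \<in> O_plus" and a: "\<And>n. 0 \<le> a n"
    and s: "\<And>z. norm z < 1 \<Longrightarrow> (\<lambda>n. complex_of_real (a n) * z ^ n) sums f z"
    and c: "0 < c" and le: "\<And>n. c * taylor_coeff g n \<le> a (n + m)"
  shows "f \<in> O_plus"
proof -
  have "1 \<le> conv_radius a"
  proof (rule conv_radius_geI_ex')
    fix r :: real assume r: "0 < r" "ereal r < 1"
    then have "(\<lambda>n. complex_of_real (a n * r ^ n)) sums f (complex_of_real r)"
      using s[of "complex_of_real r"] by simp
    from sums_summable[OF sums_Re[OF this]] show "summable (\<lambda>n. a n * of_real r ^ n)"
      by simp
  qed
  moreover have "conv_radius a \<le> conv_radius (taylor_coeff g)"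
  proof (rule conv_radius_geI_ex')
    fix r :: real assume r: "0 < r" "ereal r < conv_radius a"
    then have "summable (\<lambda>n. a (n + m) * r ^ n)"
      by (intro summable_in_conv_radius) (simp add: conv_radius_shift)
    then have "summable (\<lambda>n. (a (n + m) * r ^ n) / c)"
      by (rule summable_divide)
    then have "summable (\<lambda>n. taylor_coeff g n * r ^ n)"
    proof (rule summable_comparison_test')
      show "norm (taylor_coeff g n * r ^ n) \<le> (a (n + m) * r ^ n) / c" for n
        using mult_right_mono[OF le[of n], of "r ^ n"] taylor_coeff_nonneg[OF g, of n] r c
        by (simp add: field_simps)
    qed
    then show "summable (\<lambda>n. taylor_coeff g n * of_real r ^ n)"
      by simp
  qed
  ultimately have "conv_radius a = 1"
    using conv_radius_taylor_coeff[OF g] by simp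
  moreover have "\<exists>n. a n \<noteq> 0"
  proof -
    obtain n where "taylor_coeff g n \<noteq> 0"
      using taylor_coeff_neq_0[OF g] by blast
    then have "0 < c * taylor_coeff g n"
      using taylor_coeff_nonneg[OF g, of n] c by simp
    then show ?thesis
      using le[of n] by (intro exI[of _ "n + m"]) auto
  qed
  ultimately show ?thesis
    using a s unfolding O_plus_def by (intro CollectI exI[of _ a]) simp
qed

text \<open>The coefficients of the Cauchy product are sums of nonnegative terms, so each single
  term is a lower bound. This bound also supplies the domination required by
  \<open>O_plusI\<close>.\<close>

lemma
  assumes f: "f \<in> O_plus" and g: "g \<in> O_plus"
  shows O_plus_mult: "(\<lambda>z. f z * g z) \<in> O_plus"
    and taylor_coeff_mult_ge: "\<And>m n. taylor_coeff f n * taylor_coeff g m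
          \<le> taylor_coeff (\<lambda>z. f z * g z) (n + m)"
proof -
  define c where "c n = (\<Sum>i\<le>n. taylor_coeff f i * taylor_coeff g (n - i))" for n
  have abs: "summable (\<lambda>n. norm (complex_of_real (taylor_coeff h n) * z ^ n))"
    if "h \<in> O_plus" "norm z < 1" for h and z :: complex
  proof -
    have "summable (\<lambda>n. norm (taylor_coeff h n * norm z ^ n))"
      by (rule abs_summable_in_conv_radius)
        (use that conv_radius_taylor_coeff[of h] in simp)
    then show ?thesis
      by (simp add: norm_mult norm_power abs_mult)
  qed
  have s: "(\<lambda>n. complex_of_real (c n) * z ^ n) sums (f z * g z)" if z: "norm z < 1" for z
  proof -
    have "(\<lambda>n. \<Sum>i\<le>n. (complex_of_real (taylor_coeff f i) * z ^ i) *
        (complex_of_real (taylor_coeff g (n - i)) * z ^ (n - i))) sums (f z * g z)"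
      using Cauchy_product_sums[OF abs[OF f z] abs[OF g z]]
        O_plus_sums[OF f z] O_plus_sums[OF g z] by (simp add: sums_iff)
    also have "(\<lambda>n. \<Sum>i\<le>n. (complex_of_real (taylor_coeff f i) * z ^ i) *
        (complex_of_real (taylor_coeff g (n - i)) * z ^ (n - i))) =
        (\<lambda>n. complex_of_real (c n) * z ^ n)"
      unfolding c_def of_real_sum sum_distrib_right
      by (intro ext sum.cong refl) (auto simp: algebra_simps simp flip: power_add)
    finally show ?thesis .
  qed
  have le: "taylor_coeff f n * taylor_coeff g m \<le> c (n + m)" for m n
    unfolding c_def
    by (rule order_trans[OF _ member_le_sum[where i = n]])
      (auto intro!: mult_nonneg_nonneg taylor_coeff_nonneg f g)
  have "taylor_coeff (\<lambda>z. f z * g z) = c"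
    by (rule taylor_coeff_O_plus) (use s in simp)
  then show "taylor_coeff f n * taylor_coeff g m \<le> taylor_coeff (\<lambda>z. f z * g z) (n + m)" for m n
    using le by simp
  \<comment> \<open>In \<open>O_plusI\<close>, the index of a positive coefficient of
    \<open>g\<close> serves as the shift and that coefficient as the constant.\<close>
  obtain m where "taylor_coeff g m \<noteq> 0"
    using taylor_coeff_neq_0[OF g] by blast
  then have m: "0 < taylor_coeff g m"
    using taylor_coeff_nonneg[OF g, of m] by simp
  show "(\<lambda>z. f z * g z) \<in> O_plus"
  proof (rule O_plusI[OF f _ s m])
    show "0 \<le> c n" for n
      unfolding c_def by (intro sum_nonneg mult_nonneg_nonneg taylor_coeff_nonneg f g)
    show "taylor_coeff g m * taylor_coeff f n \<le> c (n + m)" for n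
      using le[of n m] by (simp add: mult.commute)
  qed
qed

lemma O_plus_prod:
  assumes "finite A" "A \<noteq> {}" "\<And>k. k \<in> A \<Longrightarrow> f k \<in> O_plus"
  shows "(\<lambda>z. \<Prod>k\<in>A. f k z) \<in> O_plus"
  using assms by (induction rule: finite_ne_induct) (auto intro: O_plus_mult)

section \<open>Characteristic functions and convolutions\<close>

text \<open>Multiplying the weight at \<open>n\<close> by \<open>iexp (x * n)\<close> turns
  \<open>t ^ n\<close> into \<open>(t * iexp x) ^ n\<close>, and this point still has modulus
  \<open>t < 1\<close>.\<close>

lemma char_mu:
  assumes f: "f \<in> O_plus" and t: "t \<in> {0<..<1}"
  shows "char (mu t f) x = f (complex_of_real t * iexp x) / f (complex_of_real t)"
proof -
  define F where "F = Re (f (complex_of_real t))"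
  have F: "0 < F" "f (complex_of_real t) = complex_of_real F"
    using real_distribution_mu(1)[OF f t] O_plus_of_real[OF f, of t] t by (auto simp: F_def)
  define w where "w n = taylor_coeff f n * t ^ n / F" for n
  have w: "0 \<le> w n" for n
    using taylor_coeff_nonneg[OF f, of n] t F by (simp add: w_def)
  have nrm: "norm (complex_of_real t * iexp x) < 1"
    using t by (simp add: norm_mult)
  have w_iexp: "w n *\<^sub>R iexp (x * real n) =
      complex_of_real (taylor_coeff f n) * (complex_of_real t * iexp x) ^ n / complex_of_real F" for n
    by (simp add: w_def scaleR_conv_of_real power_mult_distrib exp_of_nat_mult[symmetric] mult_ac)
  have sums: "(\<lambda>n. w n *\<^sub>R iexp (x * real n)) sums
      (f (complex_of_real t * iexp x) / complex_of_real F)"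
    unfolding w_iexp by (intro sums_divide O_plus_sums f nrm)
  \<comment> \<open>Absolute summability is what allows the integral over the counting measure to be
    computed as a series.\<close>
  have "summable (\<lambda>n. norm (taylor_coeff f n * t ^ n))"
    by (rule abs_summable_in_conv_radius) (use t conv_radius_taylor_coeff[OF f] in simp)
  from summable_divide[OF this, of F] have "summable (\<lambda>n. norm (w n *\<^sub>R iexp (x * real n)))"
    using F by (simp add: w_def)
  then have int: "integrable (count_space UNIV) (\<lambda>n. w n *\<^sub>R iexp (x * real n))"
    by (simp add: integrable_count_space_nat_iff)
  have "char (mu t f) x = (CLINT n|density (count_space UNIV) (\<lambda>n. ennreal (w n)). iexp (x * real n))"
    unfolding char_def mu_def w_def F_def by (subst integral_distr) auto
  also have "\<dots> = (CLINT n|count_space UNIV. w n *\<^sub>R iexp (x * real n))"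
    by (rule integral_density) (use w in auto)
  also have "\<dots> = f (complex_of_real t * iexp x) / complex_of_real F"
    using integral_count_space_nat[OF int] sums by (simp add: sums_iff)
  finally show ?thesis
    by (simp add: F)
qed

lemma char_convolution:
  assumes "real_distribution M" "real_distribution N"
  shows "char (M \<star> N) x = char M x * char N x"
proof -
  interpret M: real_distribution M by fact
  interpret N: real_distribution N by fact
  interpret P: pair_prob_space M N ..
  \<comment> \<open>The integrand has modulus 1, so Fubini's theorem applies on the product
    probability space.\<close>
  have int: "integrable (M \<Otimes>\<^sub>M N) (\<lambda>(u, v). iexp (x * (u + v)))"
    by (rule P.integrable_const_bound[where B = 1]) (auto simp: case_prod_beta)
  have "char (M \<star> N) x = (CLINT p|M \<Otimes>\<^sub>M N. (case p of (u, v) \<Rightarrow> iexp (x * (u + v))))"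
    unfolding char_def convolution_def by (subst integral_distr) (simp_all add: case_prod_unfold)
  also have "\<dots> = (CLINT u|M. CLINT v|N. iexp (x * (u + v)))"
    using P.integral_fst'[OF int] by simp
  also have "\<dots> = (CLINT u|M. iexp (x * u) * (CLINT v|N. iexp (x * v)))"
    by (simp add: ring_distribs exp_add)
  also have "\<dots> = char M x * char N x"
    by (simp add: char_def)
  finally show ?thesis .
qed

lemma real_distribution_convolution:
  assumes "real_distribution M" "real_distribution N"
  shows "real_distribution (M \<star> N)"
proof -
  interpret M: real_distribution M by fact
  interpret N: real_distribution N by fact
  interpret P: pair_prob_space M N ..
  have "prob_space (M \<star> N)"
    unfolding convolution_def by (rule P.prob_space_distr) simp
  then show ?thesis
    by (auto simp: real_distribution_def real_distribution_axioms_def)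
qed

lemma mu_mult:
  assumes f: "f \<in> O_plus" and g: "g \<in> O_plus" and t: "t \<in> {0<..<1}"
  shows "mu t (\<lambda>z. f z * g z) = (mu t f \<star> mu t g)"
proof (rule Levy_uniqueness)
  note distr = real_distribution_mu(2)[OF _ t]
  show "real_distribution (mu t (\<lambda>z. f z * g z))"
    by (intro distr O_plus_mult f g)
  show "real_distribution (mu t f \<star> mu t g)"
    by (intro real_distribution_convolution distr f g)
  show "char (mu t (\<lambda>z. f z * g z)) = char (mu t f \<star> mu t g)"
    by (rule ext) (simp add: char_convolution distr f g char_mu[OF _ t] O_plus_mult)
qed

lemma mu_prod:
  assumes f: "\<And>k. 1 \<le> k \<Longrightarrow> f k \<in> O_plus" and t: "t \<in> {0<..<1}" and n: "1 \<le> n"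
  shows "mu t (\<lambda>z. \<Prod>k = 1..n. f k z) = iter_conv (\<lambda>k. mu t (f k)) n"
  using n
\<comment> \<open>The induction starts at 1: the empty product is the constant 1, whose series has
  infinite radius, so it lies outside \<open>O_plus\<close>.\<close>
proof (induction n rule: nat_induct_at_least)
  case base
  interpret real_distribution "mu t (f 1)"
    by (intro real_distribution_mu f t) simp
  have "(return borel 0 \<star> mu t (f 1)) = mu t (f 1)"
    by (intro return_0_convolution prob_space_axioms events_eq_borel)
  then show ?case
    by simp
next
  case (Suc n)
  have "(\<lambda>z. \<Prod>k = 1..n. f k z) \<in> O_plus"
    using Suc.hyps by (intro O_plus_prod f) auto
  from mu_mult[OF this _ t, of "f (Suc n)"] show ?case
    using Suc.IH f by simp
qed

section \<open>Passage to the infinite product\<close>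

text \<open>Locally uniform limits of holomorphic functions commute with derivatives, and
  coefficients are derivatives at 0 divided by factorials.\<close>

lemma fps_nth_fps_expansion_tendsto:
  assumes ul: "uniform_limit (ball 0 r) P F sequentially" and r: "0 < r"
    and hol: "\<And>n. P n holomorphic_on ball 0 r"
  shows "(\<lambda>n. fps_nth (fps_expansion (P n) 0) j) \<longlonglongrightarrow> fps_nth (fps_expansion F 0) j"
proof -
  have "(\<lambda>n. (deriv ^^ j) (P n) 0) \<longlonglongrightarrow> (deriv ^^ j) F 0"
    by (rule higher_deriv_complex_uniform_limit[OF ul]) (use r hol in auto)
  then show ?thesis
    by (auto simp: fps_expansion_def intro: tendsto_intros)
qed

theorem theorem2p2:
  fixes f :: "nat \<Rightarrow> complex \<Rightarrow> complex"
  assumes "\<And>n. n \<ge> 1 \<Longrightarrow> f n \<in> O_plus"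
    and "prod_converges_compactly_on f (ball 0 1)"
  shows "(\<lambda>z. \<Prod>k. f (Suc k) z) \<in> O_plus \<and>
    (\<forall>t \<in> {0<..<1}.
      (\<forall>n \<ge> 1. prob_space (mu t (\<lambda>z. \<Prod>k = 1..n. f k z)) \<and>
         mu t (\<lambda>z. \<Prod>k = 1..n. f k z) = iter_conv (\<lambda>k. mu t (f k)) n) \<and>
      weak_conv_m (\<lambda>n. mu t (\<lambda>z. \<Prod>k = 1..n. f k z)) (mu t (\<lambda>z. \<Prod>k. f (Suc k) z)))"
proof -
  define P where "P n z = (\<Prod>k = 1..n. f k z)" for n z
  define F where "F z = (\<Prod>k. f (Suc k) z)" for z
  have conv: "convergent_prod (\<lambda>k. f (Suc k) z)" if "norm z < 1" for z
    using assms(2) that unfolding prod_converges_compactly_on_def by simp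
  have ul: "uniform_limit K P F sequentially" if "compact K" "K \<subseteq> ball 0 1" for K
    using assms(2) that unfolding prod_converges_compactly_on_def P_def F_def by blast
  have P: "P n \<in> O_plus" if "1 \<le> n" for n
    using that unfolding P_def by (intro O_plus_prod assms(1)) auto
  have holP: "P n holomorphic_on ball 0 1" for n
    unfolding P_def by (intro holomorphic_intros O_plus_holomorphic assms(1)) auto
  have holF: "F holomorphic_on ball 0 1"
  proof (rule holomorphic_uniform_sequence[OF _ holP])
    fix z :: complex assume "z \<in> ball 0 1"
    then have "\<exists>d>0. cball z d \<subseteq> ball 0 1"
      by (rule open_contains_cball[THEN iffD1, OF open_ball, rule_format])
    then obtain d where "0 < d" "cball z d \<subseteq> ball 0 1"
      by blast
    then show "\<exists>d>0. cball z d \<subseteq> ball 0 1 \<and> uniform_limit (cball z d) P F sequentially"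
      by (intro exI[of _ d] conjI ul compact_cball)
  qed simp
  have lim: "(\<lambda>n. P n z) \<longlonglongrightarrow> F z" if "norm z < 1" for z
    using tendsto_uniform_limitI[OF ul[of "{z}"], of z] that by simp
  define a where "a = taylor_coeff F"
  have coeff: "(\<lambda>n. fps_nth (fps_expansion (P n) 0) j) \<longlonglongrightarrow> fps_nth (fps_expansion F 0) j" for j
  proof (rule fps_nth_fps_expansion_tendsto)
    \<comment> \<open>Any radius below 1 would do: the closed disk is then a compact subset of the
      unit disk.\<close>
    show "uniform_limit (ball 0 (1/2)) P F sequentially"
      by (rule uniform_limit_on_subset[OF ul[of "cball 0 (1/2)"]]) auto
    show "P n holomorphic_on ball 0 (1/2)" for n
      by (rule holomorphic_on_subset[OF holP]) auto
  qed simp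
  have coeff_a: "(\<lambda>n. taylor_coeff (P n) j) \<longlonglongrightarrow> a j" for j
    unfolding a_def taylor_coeff_def by (intro tendsto_intros coeff)
  have F: "F \<in> O_plus"
  proof -
    obtain M p where "raw_has_prod (\<lambda>k. f (Suc k) 0) M p"
      using conv[of 0] by (auto simp: convergent_prod_def)
    \<comment> \<open>From index \<open>M\<close> on, the partial products at 0 have a nonzero
      limit. Passing to \<open>Suc M\<close> ensures \<open>1 \<le> N\<close>, so that
      \<open>P N\<close> lies in \<open>O_plus\<close>.\<close>
    then obtain q where q: "raw_has_prod (\<lambda>k. f (Suc k) 0) (Suc M) q"
      by (rule raw_has_prod_ignore_initial_segment[where N = "Suc M"]) auto
    define N where "N = Suc M"
    \<comment> \<open>\<open>P N\<close> has the factors 1 to \<open>N\<close>, and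
      \<open>Q n\<close> those from \<open>N + 1\<close> to \<open>N + n + 1\<close>; hence the
      offset \<open>Suc N\<close> in \<open>PQ\<close>.\<close>
    define Q where "Q n z = (\<Prod>i\<le>n. f (Suc (i + N)) z)" for n z
    have Q: "Q n \<in> O_plus" for n
      unfolding Q_def by (intro O_plus_prod assms(1)) auto
    have PQ: "P (n + Suc N) = (\<lambda>z. P N z * Q n z)" for n
      unfolding P_def Q_def by (induction n) (auto simp: fun_eq_iff)
    have Qlim: "(\<lambda>n. taylor_coeff (Q n) 0) \<longlonglongrightarrow> Re q"
      unfolding taylor_coeff_0[OF Q] using q
      by (auto simp: Q_def N_def raw_has_prod_def intro: tendsto_intros)
    \<comment> \<open>As a limit of nonnegative reals, \<open>q\<close> is real and nonnegative. It
      is nonzero by \<open>raw_has_prod\<close>, hence positive.\<close>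
    have "Im (Q n 0) = 0" for n
      using O_plus_of_real[OF Q[of n], of 0] by (simp add: complex_eq_iff)
    moreover have "(\<lambda>n. Im (Q n 0)) \<longlonglongrightarrow> Im q"
      using q by (auto simp: Q_def N_def raw_has_prod_def intro: tendsto_intros)
    ultimately have "Im q = 0"
      by (simp add: LIMSEQ_const_iff)
    moreover have "0 \<le> Re q"
      by (rule LIMSEQ_le_const[OF Qlim]) (auto intro: taylor_coeff_nonneg Q)
    ultimately have "0 < Re q"
      using q by (auto simp: raw_has_prod_def complex_eq_iff)
    have a_nonneg: "0 \<le> a j" for j
      by (rule LIMSEQ_le_const[OF coeff_a]) (auto intro!: exI[of _ 1] taylor_coeff_nonneg P)
    show ?thesis
    proof (rule O_plusI[of "P N" a F "Re q" 0])
      show "Re q * taylor_coeff (P N) j \<le> a (j + 0)" for j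
      proof (rule LIMSEQ_le)
        show "(\<lambda>n. taylor_coeff (P N) j * taylor_coeff (Q n) 0) \<longlonglongrightarrow> Re q * taylor_coeff (P N) j"
          using tendsto_mult_left[OF Qlim, of "taylor_coeff (P N) j"] by (simp add: mult.commute)
        show "(\<lambda>n. taylor_coeff (P (n + Suc N)) j) \<longlonglongrightarrow> a (j + 0)"
          using LIMSEQ_ignore_initial_segment[OF coeff_a, of "Suc N" j] by simp
        show "\<exists>n0. \<forall>n\<ge>n0. taylor_coeff (P N) j * taylor_coeff (Q n) 0 \<le> taylor_coeff (P (n + Suc N)) j"
          unfolding PQ using taylor_coeff_mult_ge[OF P Q, where m = 0] by (simp add: N_def)
      qed
      fix z :: complex assume z: "norm z < 1"
      \<comment> \<open>\<open>a\<close> records only real parts, so the imaginary parts of the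
        coefficients of \<open>F\<close> must be shown to vanish; they are limits of zeros.\<close>
      have "fps_nth (fps_expansion F 0) n = complex_of_real (a n)" for n
      proof -
        have "Im (fps_nth (fps_expansion (P k) 0) n) = 0" if "1 \<le> k" for k
          using fps_expansion_O_plus[OF P[OF that]] by simp
        then have "(\<lambda>k. Im (fps_nth (fps_expansion (P k) 0) n)) \<longlonglongrightarrow> 0"
          by (intro tendsto_eventually) (auto simp: eventually_at_top_linorder)
        moreover have "(\<lambda>k. Im (fps_nth (fps_expansion (P k) 0) n)) \<longlonglongrightarrow> Im (fps_nth (fps_expansion F 0) n)"
          by (intro tendsto_intros coeff)
        ultimately have "Im (fps_nth (fps_expansion F 0) n) = 0"
          using LIMSEQ_unique by blast
        then show ?thesis
          by (simp add: a_def taylor_coeff_def complex_eq_iff)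
      qed
      then show "(\<lambda>n. complex_of_real (a n) * z ^ n) sums F z"
        using holomorphic_power_series[OF holF, of z] z by (simp add: fps_expansion_def)
    qed (use P a_nonneg \<open>0 < Re q\<close> in \<open>auto simp: N_def\<close>)
  qed
  have "weak_conv_m (\<lambda>n. mu t (P n)) (mu t F)" if t: "t \<in> {0<..<1}" for t
  proof -
    have F_t: "F (complex_of_real t) \<noteq> 0"
      using real_distribution_mu(1)[OF F t] by auto
    \<comment> \<open>The shift by one skips the empty product \<open>P 0\<close>, so that every
      term is covered by \<open>P\<close> and \<open>char_mu\<close>; it does not affect the
      limit.\<close>
    have "weak_conv_m (\<lambda>n. mu t (P (Suc n))) (mu t F)"
    proof (rule levy_continuity)
      show "real_distribution (mu t (P (Suc n)))" for n
        by (intro real_distribution_mu P t) simp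
      show "real_distribution (mu t F)"
        by (intro real_distribution_mu F t)
      show "(\<lambda>n. char (mu t (P (Suc n))) x) \<longlonglongrightarrow> char (mu t F) x" for x
        using t F_t
        by (auto simp: char_mu F P norm_mult intro!: tendsto_divide LIMSEQ_Suc lim)
    qed
    then show ?thesis
      by (auto simp: weak_conv_m_def weak_conv_def intro: LIMSEQ_imp_Suc)
  qed
  then show ?thesis
    using F mu_prod[OF assms(1)] real_distribution_mu(2)[OF P]
    by (auto simp: F_def[abs_def] P_def[abs_def] real_distribution_def)
qed

end
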